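(* Let $X=\{x\in\mathbb{R}^n:\bar h(x)\ge0\}$, where $\bar h$ is a tuple of real polynomials. Suppose $(\bar x,\bar y)$ is a global optimizer of the problem: minimize $f(x)$ over $(x,y)$ subject to $A^Ty=0$, $b(x)^Ty=1$, $y\ge0$, $x\in X$, $y\in\mathbb{R}^m$. If $\bar h(\bar x)>0$ (componentwise), then $\bar x$ is a local optimizer of the generalized semi-infinite program: minimize $f(x)$ over $x\in X$ subject to $g(x,u)\ge0$ for all $u\in U(x)$.
   Context: Setting: $x\in\mathbb{R}^n$, $u\in\mathbb{R}^p$; $f(x)$, $g(x,u)$ are real polynomials; $A\in\mathbb{R}^{m\times p}$ is a constant matrix; $b(x)=(b_1(x),\dots,b_m(x))^T$ is a vector of real polynomials; $U(x)=\{u\in\mathbb{R}^p: Au\ge b(x)\}$. It is assumed that $U$ is locally bounded on $X$: every $\hat x\in X$ has a neighborhood $C_1$ and a bounded set $C_2$ with $U(x)\subseteq C_2$ for all $x\in C_1$. If $U(x)=\emptyset$, the constraint "$g(x,u)\ge0$ for all $u\in U(x)$" holds vacuously. *)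

theory Defs
  imports "HOL-Analysis.Analysis"
begin

text \<open>
  Real polynomials are represented by the functions they induce, via the library predicate
  \<^const>\<open>real_polynomial_function\<close>: on a Euclidean space, these are the
  functions generated from the linear forms (equivalently, the coordinates) and the constants
  by addition and multiplication.
  The order on \<^typ>\<open>real ^ 'n\<close> is the componentwise one.
\<close>

definition constr_set :: "(real ^ 'n \<Rightarrow> real) list \<Rightarrow> (real ^ 'n) set"
  where "constr_set hs = {x. \<forall>h\<in>set hs. h x \<ge> 0}"

definition param_set :: "real ^ 'p ^ 'm \<Rightarrow> (real ^ 'n \<Rightarrow> real ^ 'm) \<Rightarrow> real ^ 'n \<Rightarrow> (real ^ 'p) set"
  where "param_set A b x = {u. A *v u \<ge> b x}"

definition locally_bounded_on ::
    "'a::topological_space set \<Rightarrow> ('a \<Rightarrow> 'b::metric_space set) \<Rightarrow> bool"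
  where "locally_bounded_on X U \<longleftrightarrow>
    (\<forall>x0\<in>X. \<exists>C1 C2. open C1 \<and> x0 \<in> C1 \<and> bounded C2 \<and> (\<forall>x\<in>C1. U x \<subseteq> C2))"

definition gsip_feasible ::
    "'a set \<Rightarrow> ('a \<Rightarrow> 'b set) \<Rightarrow> ('a \<Rightarrow> 'b \<Rightarrow> real) \<Rightarrow> 'a set"
  where "gsip_feasible X U g = {x \<in> X. \<forall>u\<in>U x. g x u \<ge> 0}"

definition multiplier_feasible ::
    "(real ^ 'n) set \<Rightarrow> real ^ 'p ^ 'm \<Rightarrow> (real ^ 'n \<Rightarrow> real ^ 'm) \<Rightarrow> ((real ^ 'n) \<times> (real ^ 'm)) set"
  where "multiplier_feasible X A b =
    {(x, y). transpose A *v y = 0 \<and> b x \<bullet> y = 1 \<and> y \<ge> 0 \<and> x \<in> X}"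

definition global_minimizer :: "('a \<Rightarrow> real) \<Rightarrow> 'a set \<Rightarrow> 'a \<Rightarrow> bool"
  where "global_minimizer F S x \<longleftrightarrow> is_arg_min F (\<lambda>z. z \<in> S) x"

definition local_minimizer :: "('a::topological_space \<Rightarrow> real) \<Rightarrow> 'a set \<Rightarrow> 'a \<Rightarrow> bool"
  where "local_minimizer F S x \<longleftrightarrow> (\<exists>N. open N \<and> x \<in> N \<and> global_minimizer F (S \<inter> N) x)"

end

theory Submission
  imports Defs
begin

text \<open>
  The multiplier \<open>ybar\<close> certifies, in the sense of Farkas, that the parameter set is empty at
  \<open>xbar\<close>, which makes \<open>xbar\<close> feasible. The same \<open>ybar\<close>, rescaled by
  \<open>1 / (b x \<bullet> ybar)\<close>, is a multiplier at every \<open>x\<close> of the open set where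
  \<open>b x \<bullet> ybar > 0\<close>, so global optimality in \<open>(x, y)\<close> bounds \<open>f\<close> from below near \<open>xbar\<close>.
\<close>

lemma vec_inner_mono:
  fixes y v w :: "real ^ 'm"
  assumes "y \<ge> 0" "v \<le> w"
  shows "v \<bullet> y \<le> w \<bullet> y"
  using assms by (auto simp: inner_vec_def less_eq_vec_def intro!: sum_mono mult_right_mono)

text \<open>The easy direction of Farkas: pairing \<open>A *v u \<ge> b x\<close> with
  \<open>y \<ge> 0\<close> and moving \<open>A\<close> to the other side would give
  \<open>1 \<le> u \<bullet> 0\<close>.\<close>

lemma param_set_empty_if_multiplier:
  assumes "(x, y) \<in> multiplier_feasible X A b"
  shows "param_set A b x = {}"
proof -
  have y: "transpose A *v y = 0" "b x \<bullet> y = 1" "y \<ge> 0"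
    using assms by (auto simp: multiplier_feasible_def)
  have False if "u \<in> param_set A b x" for u
  proof -
    have "b x \<bullet> y \<le> (A *v u) \<bullet> y"
      using that y(3) by (intro vec_inner_mono) (auto simp: param_set_def)
    also have "\<dots> = u \<bullet> (transpose A *v y)"
      by (metis dot_lmul_matrix inner_commute transpose_matrix_vector)
    finally show False
      using y by simp
  qed
  then show ?thesis by blast
qed

text \<open>The conditions \<open>transpose A *v y = 0\<close> and \<open>y \<ge> 0\<close> define a
  cone that does not depend on \<open>x\<close>, so a positive scaling only has to restore the
  normalization.\<close>

lemma multiplier_feasible_rescale:
  fixes y :: "real ^ 'm"
  assumes "transpose A *v y = 0" "y \<ge> 0" "b x \<bullet> y > 0" "x \<in> X"
  shows "(x, (1 / (b x \<bullet> y)) *\<^sub>R y) \<in> multiplier_feasible X A b"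
proof -
  have "transpose A *v ((1 / (b x \<bullet> y)) *\<^sub>R y) = 0"
    unfolding matrix_vector_mult_scaleR assms(1) by simp
  then show ?thesis
    using assms by (auto simp: multiplier_feasible_def less_eq_vec_def)
qed

theorem theorem4p7:
  fixes f :: "real ^ 'n \<Rightarrow> real"
    and g :: "real ^ 'n \<Rightarrow> real ^ 'p \<Rightarrow> real"
    and A :: "real ^ 'p ^ 'm"
    and b :: "real ^ 'n \<Rightarrow> real ^ 'm"
    and hs :: "(real ^ 'n \<Rightarrow> real) list"
    and xbar :: "real ^ 'n"
    and ybar :: "real ^ 'm"
  assumes "real_polynomial_function f"
    and "real_polynomial_function (\<lambda>(x, u). g x u)"
    and "\<And>i. real_polynomial_function (\<lambda>x. b x $ i)"
    and "\<And>h. h \<in> set hs \<Longrightarrow> real_polynomial_function h"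
    and "locally_bounded_on (constr_set hs) (param_set A b)"
    and "global_minimizer (\<lambda>(x, y). f x) (multiplier_feasible (constr_set hs) A b) (xbar, ybar)"
    and "\<And>h. h \<in> set hs \<Longrightarrow> h xbar > 0"
  shows "local_minimizer f (gsip_feasible (constr_set hs) (param_set A b) g) xbar"
proof -
  \<comment> \<open>The objective ignores \<open>y\<close>, so \<open>f xbar\<close> is compared
    with \<open>f x\<close> at every \<open>x\<close> that admits some multiplier.\<close>
  have opt: "(xbar, ybar) \<in> multiplier_feasible (constr_set hs) A b"
    "\<And>x y. (x, y) \<in> multiplier_feasible (constr_set hs) A b \<Longrightarrow> f xbar \<le> f x"
    using assms(6) by (auto simp: global_minimizer_def is_arg_min_linorder)
  then have ybar: "transpose A *v ybar = 0" "b xbar \<bullet> ybar = 1" "ybar \<ge> 0" "xbar \<in> constr_set hs"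
    by (auto simp: multiplier_feasible_def)
  define N where "N = {x. b x \<bullet> ybar > 0}"
  have "continuous_on UNIV (\<lambda>x. b x $ i)" for i
    using assms(3) by (simp add: continuous_at_imp_continuous_on continuous_real_polymonial_function)
  then have "continuous_on UNIV (\<lambda>x. b x \<bullet> ybar)"
    unfolding inner_vec_def by (intro continuous_on_sum continuous_on_inner continuous_on_const)
  then have "open N"
    unfolding N_def by (intro open_Collect_less continuous_on_const)
  moreover have "xbar \<in> N"
    using ybar by (simp add: N_def)
  moreover have "xbar \<in> gsip_feasible (constr_set hs) (param_set A b) g"
    using ybar(4) param_set_empty_if_multiplier[OF opt(1)] by (simp add: gsip_feasible_def)
  \<comment> \<open>The bound covers all of \<open>constr_set hs\<close> inside \<open>N\<close>,
    whatever the sign of \<open>g\<close>; the feasible points in \<open>N\<close> are among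
    these.\<close>
  moreover have "f xbar \<le> f x" if "x \<in> N" "x \<in> constr_set hs" for x
    using that ybar opt(2)[OF multiplier_feasible_rescale] by (simp add: N_def)
  ultimately show ?thesis
    unfolding local_minimizer_def global_minimizer_def is_arg_min_linorder
    by (intro exI[of _ N]) (auto simp: gsip_feasible_def)
qed

end
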